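(* Let $H$ be a real Hilbert space, let $\{T_n\}_{n\in\mathbb N}$ be a sequence of nonexpansive mappings $T_n\colon H\to H$ having a common fixed point, and let $F=\bigcap_{n=1}^\infty \operatorname{Fix}(T_n)$. Let $\kappa,\eta$ be positive real numbers with $\eta^2<2\kappa$, and let $A\colon H\to H$ be $\kappa$-strongly monotone and $\eta$-lipschitzian. Let $\{\lambda_n\}_{n\in\mathbb N}$ be a sequence in $[0,1]$ such that $\sum_{n=1}^\infty\lambda_n=\infty$. Suppose that for every $(x,u)\in H\times H$ the sequence $\{x_n\}$ defined by $x_1=x$ and $$x_{n+1}=\lambda_n u+(1-\lambda_n)T_nx_n\qquad(n\in\mathbb N)$$ converges strongly to $P_F(u)$. Let $y\in H$ and let $\{y_n\}$ be the sequence defined by $y_1=y$ and $$y_{n+1}=(I-\lambda_nA)T_ny_n\qquad(n\in\mathbb N).$$ Then $\{y_n\}$ converges strongly to the unique solution of the variational inequality problem: find $z\in F$ such that $\langle y'-z,Az\rangle\ge 0$ for all $y'\in F$.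
   Context: $\mathbb N$ is the set of positive integers, $I$ is the identity mapping on $H$, and $(I-\lambda_nA)T_ny_n$ means $T_ny_n-\lambda_nA(T_ny_n)$. $\operatorname{Fix}(T)$ is the set of fixed points of $T$. A mapping $T\colon H\to H$ is nonexpansive if $\|Tx-Ty\|\le\|x-y\|$ for all $x,y\in H$; the set $F$ is then a nonempty closed convex subset of $H$, and $P_F$ denotes the metric projection of $H$ onto $F$. A mapping $A\colon H\to H$ is $\kappa$-strongly monotone if $\langle x-y,Ax-Ay\rangle\ge\kappa\|x-y\|^2$ for all $x,y\in H$, and $\eta$-lipschitzian if $\|Ax-Ay\|\le\eta\|x-y\|$ for all $x,y\in H$. Strong convergence means convergence in norm. *)

theory Defs
  imports "HOL-Analysis.Analysis"
begin

definition Fix :: "('a \<Rightarrow> 'a) \<Rightarrow> 'a set"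
  where "Fix T = {x. T x = x}"

definition nonexpansive :: "('a::real_normed_vector \<Rightarrow> 'a) \<Rightarrow> bool"
  where "nonexpansive T \<longleftrightarrow> (\<forall>x y. norm (T x - T y) \<le> norm (x - y))"

definition strongly_monotone :: "real \<Rightarrow> ('a::real_inner \<Rightarrow> 'a) \<Rightarrow> bool"
  where "strongly_monotone \<kappa> A \<longleftrightarrow>
    (\<forall>x y. inner (x - y) (A x - A y) \<ge> \<kappa> * (norm (x - y))\<^sup>2)"

(* Metric projection onto S. The library's closest_point is restricted to
   heine_borel spaces, i.e. to finite dimension. The description is meaningful
   for S nonempty, closed and convex in a Hilbert space. *)
definition metric_proj :: "'a::real_inner set \<Rightarrow> 'a \<Rightarrow> 'a"
  where "metric_proj S u = (THE z. z \<in> S \<and> (\<forall>w\<in>S. norm (u - z) \<le> norm (u - w)))"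

definition VI_solution :: "'a::real_inner set \<Rightarrow> ('a \<Rightarrow> 'a) \<Rightarrow> 'a \<Rightarrow> bool"
  where "VI_solution S A z \<longleftrightarrow> z \<in> S \<and> (\<forall>w\<in>S. inner (w - z) (A z) \<ge> 0)"

end

theory Submission
  imports Defs
begin

text \<open>The map \<open>f = I - A\<close> is a strict contraction, and the iteration reads
  \<open>y (n + 1) = lam n *\<^sub>R f (T n (y n)) + (1 - lam n) *\<^sub>R T n (y n)\<close>.
  Let \<open>z\<close> be the Banach fixed point of \<open>P\<^sub>F \<circ> f\<close>; the projection inequality says that \<open>z\<close>
  solves the variational inequality. The Halpern iteration \<open>xs\<close> with the constant anchor \<open>f z\<close>
  converges to \<open>P\<^sub>F (f z) = z\<close>, and \<open>norm (xs n - y n)\<close> satisfies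
  a recursive inequality that forces it to tend to 0.\<close>

section \<open>Fixed-point sets of nonexpansive maps\<close>

lemma closed_Fix:
  fixes T :: "'a::real_normed_vector \<Rightarrow> 'a"
  assumes "nonexpansive T"
  shows "closed (Fix T)"
proof -
  have "1-lipschitz_on UNIV T"
    using assms by (intro lipschitz_onI) (auto simp: nonexpansive_def dist_norm)
  then have "continuous_on UNIV T"
    by (rule lipschitz_on_continuous_on)
  then have "closed {x. T x = x}"
    by (intro closed_Collect_eq continuous_on_id)
  then show ?thesis
    by (simp add: Fix_def)
qed

text \<open>Stewart's identity, used twice: it yields convexity of \<open>Fix T\<close>, and with
  \<open>t = 1/2\<close> it is the parallelogram law behind the existence of nearest points.\<close>

lemma norm_sq_affine_combination:
  fixes p x y :: "'a::real_inner"
  shows "(norm (p - ((1 - t) *\<^sub>R x + t *\<^sub>R y)))\<^sup>2 =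
    (1 - t) * (norm (p - x))\<^sup>2 + t * (norm (p - y))\<^sup>2 - t * (1 - t) * (norm (x - y))\<^sup>2"
  unfolding power2_norm_eq_inner
  by (simp add: inner_diff_left inner_diff_right inner_add_left inner_add_right
      inner_commute[of x p] inner_commute[of y p] inner_commute[of y x]) algebra

text \<open>A point \<open>m\<close> of the segment from \<open>x\<close> to \<open>y\<close> is
  determined by its distances to the endpoints. Nonexpansiveness leaves \<open>T m\<close> no
  farther than \<open>m\<close> from \<open>x\<close> and from \<open>y\<close>, so the identity for
  \<open>p = T m\<close> forces \<open>T m = m\<close>.\<close>

lemma convex_Fix:
  fixes T :: "'a::real_inner \<Rightarrow> 'a"
  assumes "nonexpansive T"
  shows "convex (Fix T)"
  unfolding convex_alt
proof (intro ballI allI impI)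
  fix x y t assume "x \<in> Fix T" "y \<in> Fix T" and t: "0 \<le> (t::real) \<and> t \<le> 1"
  then have fix_xy: "T x = x" "T y = y"
    by (auto simp: Fix_def)
  define m where "m = (1 - t) *\<^sub>R x + t *\<^sub>R y"
  have "m - x = t *\<^sub>R (y - x)" "m - y = (1 - t) *\<^sub>R (x - y)"
    by (simp_all add: m_def algebra_simps)
  then have "norm (m - x) = t * norm (x - y)" "norm (m - y) = (1 - t) * norm (x - y)"
    using t by (simp_all add: norm_minus_commute)
  moreover have "norm (T m - x) \<le> norm (m - x)" "norm (T m - y) \<le> norm (m - y)"
    using assms[unfolded nonexpansive_def, rule_format, of m x]
      assms[unfolded nonexpansive_def, rule_format, of m y] by (simp_all only: fix_xy)
  ultimately have "(norm (T m - x))\<^sup>2 \<le> (t * norm (x - y))\<^sup>2"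
    "(norm (T m - y))\<^sup>2 \<le> ((1 - t) * norm (x - y))\<^sup>2"
    by (auto intro!: power_mono)
  then have "(1 - t) * (norm (T m - x))\<^sup>2 + t * (norm (T m - y))\<^sup>2
      \<le> (1 - t) * (t * norm (x - y))\<^sup>2 + t * ((1 - t) * norm (x - y))\<^sup>2"
    using t by (intro add_mono mult_left_mono) auto
  also have "\<dots> = t * (1 - t) * (norm (x - y))\<^sup>2"
    by (simp add: power2_eq_square algebra_simps)
  finally have "(norm (T m - m))\<^sup>2 \<le> 0"
    using norm_sq_affine_combination[of "T m" t x y] by (simp add: m_def)
  then show "(1 - t) *\<^sub>R x + t *\<^sub>R y \<in> Fix T"
    by (simp add: Fix_def m_def)
qed

section \<open>The metric projection onto a closed convex set\<close>

lemma nearest_point_exists: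
  fixes S :: "'a::{real_inner, complete_space} set"
  assumes "closed S" "convex S" "S \<noteq> {}"
  shows "\<exists>z\<in>S. \<forall>w\<in>S. norm (u - z) \<le> norm (u - w)"
proof -
  define d where "d = (INF w\<in>S. (norm (u - w))\<^sup>2)"
  have bdd: "bdd_below ((\<lambda>w. (norm (u - w))\<^sup>2) ` S)"
    by (rule bdd_belowI[of _ 0]) auto
  have d_le: "d \<le> (norm (u - w))\<^sup>2" if "w \<in> S" for w
    unfolding d_def using bdd that by (rule cINF_lower)
  have "\<exists>w\<in>S. (norm (u - w))\<^sup>2 < d + 1 / real (Suc n)" for n
    using cINF_less_iff[OF \<open>S \<noteq> {}\<close> bdd, of "d + 1 / real (Suc n)"] by (simp add: d_def)
  then obtain w where w_in: "\<And>n. w n \<in> S"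
    and w_less: "\<And>n. (norm (u - w n))\<^sup>2 < d + 1 / real (Suc n)"
    by metis
  \<comment> \<open>The midpoint of \<open>w m\<close> and \<open>w n\<close> lies in
    \<open>S\<close>, so its squared distance from \<open>u\<close> is at least \<open>d\<close>.
    Both endpoints nearly attain \<open>d\<close>, and the identity turns the small excess into a
    bound on their distance. The weight \<open>1 - 1/2\<close> is written out to match the form of
    the identity.\<close>
  have w_dist: "(norm (w m - w n))\<^sup>2 \<le> 2 / real (Suc m) + 2 / real (Suc n)" for m n
  proof -
    have "(1 - 1/2) *\<^sub>R w m + (1/2) *\<^sub>R w n \<in> S"
      using w_in by (intro convexD[OF \<open>convex S\<close>]) auto
    from d_le[OF this] show ?thesis
      using norm_sq_affine_combination[of u "1/2" "w m" "w n"] w_less[of m] w_less[of n] by simp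
  qed
  have "Cauchy w"
  proof (rule metric_CauchyI)
    fix e :: real assume "e > 0"
    then obtain N where N: "4 / e\<^sup>2 < real (Suc N)"
      using reals_Archimedean2 less_trans of_nat_less_iff lessI by metis
    show "\<exists>M. \<forall>m\<ge>M. \<forall>n\<ge>M. dist (w m) (w n) < e"
    proof (intro exI allI impI)
      fix m n assume "m \<ge> N" "n \<ge> N"
      then have "2 / real (Suc m) + 2 / real (Suc n) \<le> 2 / real (Suc N) + 2 / real (Suc N)"
        by (intro add_mono divide_left_mono) auto
      also have "\<dots> = 4 / real (Suc N)"
        by (simp add: add_divide_distrib[symmetric])
      also have "\<dots> < e\<^sup>2"
        using N \<open>e > 0\<close> by (simp add: field_simps)
      finally have "(norm (w m - w n))\<^sup>2 < e\<^sup>2"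
        using w_dist[of m n] by linarith
      then show "dist (w m) (w n) < e"
        using \<open>e > 0\<close> by (simp add: dist_norm power_less_imp_less_base)
    qed
  qed
  then obtain z where z: "w \<longlonglongrightarrow> z"
    by (metis Cauchy_convergent_iff convergent_def)
  have "z \<in> S"
    using \<open>closed S\<close> w_in z closed_sequentially by blast
  have "(\<lambda>n. (norm (u - w n))\<^sup>2) \<longlonglongrightarrow> (norm (u - z))\<^sup>2"
    by (intro tendsto_intros z)
  moreover have "(\<lambda>n. d + 1 / real (Suc n)) \<longlonglongrightarrow> d + 0"
    by (intro tendsto_intros LIMSEQ_Suc[OF lim_1_over_n])
  ultimately have "(norm (u - z))\<^sup>2 \<le> d + 0"
    by (rule LIMSEQ_le) (auto intro!: exI[of _ 0] less_imp_le[OF w_less] simp del: of_nat_Suc)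
  then have "norm (u - z) \<le> norm (u - v)" if "v \<in> S" for v
    by (rule power2_le_imp_le[OF order_trans]) (use d_le[OF that] in simp_all)
  with \<open>z \<in> S\<close> show ?thesis
    by blast
qed

lemma metric_proj_nearest:
  fixes S :: "'a::{real_inner, complete_space} set"
  assumes "closed S" "convex S" "S \<noteq> {}"
  shows "metric_proj S u \<in> S \<and> (\<forall>w\<in>S. norm (u - metric_proj S u) \<le> norm (u - w))"
  unfolding metric_proj_def
proof (rule theI', rule ex_ex1I)
  show "\<exists>z. z \<in> S \<and> (\<forall>w\<in>S. norm (u - z) \<le> norm (u - w))"
    using nearest_point_exists[OF assms, of u] by blast
next
  fix z z'
  assume "z \<in> S \<and> (\<forall>w\<in>S. norm (u - z) \<le> norm (u - w))"
    and "z' \<in> S \<and> (\<forall>w\<in>S. norm (u - z') \<le> norm (u - w))"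
  then show "z = z'"
    using any_closest_point_unique[OF assms(2,1), of z z' u] by (simp add: dist_norm)
qed

text \<open>The obtuse-angle property of nearest points. For \<open>u = z - A z\<close> with
  projection \<open>z\<close>, the first factor is \<open>- A z\<close>, so this is the variational
  inequality at \<open>z\<close>.\<close>

lemma metric_proj_inner_le_0:
  fixes S :: "'a::{real_inner, complete_space} set"
  assumes "closed S" "convex S" "w \<in> S"
  shows "inner (u - metric_proj S u) (w - metric_proj S u) \<le> 0"
proof (rule any_closest_point_dot[OF assms(2,1) _ assms(3)])
  have "S \<noteq> {}"
    using assms(3) by blast
  from metric_proj_nearest[OF assms(1,2) this, of u]
  show "metric_proj S u \<in> S" "\<forall>z\<in>S. dist u (metric_proj S u) \<le> dist u z"
    by (auto simp: dist_norm)
qed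

text \<open>Adding the obtuse-angle inequalities at the two projections gives firm nonexpansiveness;
  Cauchy-Schwarz and division by \<open>norm (p - q)\<close> finish, the case \<open>p = q\<close>
  being trivial.\<close>

lemma nonexpansive_metric_proj:
  fixes S :: "'a::{real_inner, complete_space} set"
  assumes "closed S" "convex S" "S \<noteq> {}"
  shows "nonexpansive (metric_proj S)"
  unfolding nonexpansive_def
proof (intro allI)
  fix u v
  define p where "p = metric_proj S u"
  define q where "q = metric_proj S v"
  have "inner (u - p) (q - p) \<le> 0" "inner (v - q) (p - q) \<le> 0"
    using metric_proj_inner_le_0[OF assms(1,2)] metric_proj_nearest[OF assms]
    by (simp_all add: p_def q_def)
  then have "(norm (p - q))\<^sup>2 \<le> inner (u - v) (p - q)"
    by (simp add: power2_norm_eq_inner inner_diff_left inner_diff_right inner_commute)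
  also have "\<dots> \<le> norm (u - v) * norm (p - q)"
    by (rule norm_cauchy_schwarz)
  finally show "norm (metric_proj S u - metric_proj S v) \<le> norm (u - v)"
    unfolding p_def[symmetric] q_def[symmetric]
    by (cases "p = q") (auto simp: power2_eq_square)
qed

section \<open>Consequences of strong monotonicity\<close>

lemma contraction_id_minus_strongly_monotone:
  fixes A :: "'a::real_inner \<Rightarrow> 'a"
  assumes "strongly_monotone \<kappa> A" "\<eta>-lipschitz_on UNIV A" "\<eta>\<^sup>2 < 2 * \<kappa>"
  obtains r where "0 \<le> r" "r < 1" "\<And>x y. norm ((x - A x) - (y - A y)) \<le> r * norm (x - y)"
proof
  \<comment> \<open>Expanding the square below produces the factor
    \<open>1 - 2 * \<kappa> + \<eta>\<^sup>2\<close>, which is below 1 by assumption. It can be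
    negative only in the zero space, and the maximum with 0 covers that case.\<close>
  define s where "s = max 0 (1 - 2 * \<kappa> + \<eta>\<^sup>2)"
  show "0 \<le> sqrt s" "sqrt s < 1"
    using assms(3) by (auto simp: s_def)
  fix x y
  have lip: "norm (A x - A y) \<le> \<eta> * norm (x - y)"
    using lipschitz_onD[OF assms(2)] by (simp add: dist_norm)
  have "(norm ((x - A x) - (y - A y)))\<^sup>2 =
      (norm (x - y))\<^sup>2 - 2 * inner (x - y) (A x - A y) + (norm (A x - A y))\<^sup>2"
    unfolding power2_norm_eq_inner by (simp add: inner_diff_left inner_diff_right inner_commute)
  also have "\<dots> \<le> (norm (x - y))\<^sup>2 - 2 * (\<kappa> * (norm (x - y))\<^sup>2) + (\<eta> * norm (x - y))\<^sup>2"
    using assms(1) power_mono[OF lip norm_ge_zero, of 2] unfolding strongly_monotone_def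
    by (intro add_mono diff_mono mult_left_mono) auto
  also have "\<dots> = (1 - 2 * \<kappa> + \<eta>\<^sup>2) * (norm (x - y))\<^sup>2"
    by (simp add: power_mult_distrib algebra_simps)
  also have "\<dots> \<le> s * (norm (x - y))\<^sup>2"
    by (intro mult_right_mono) (auto simp: s_def)
  also have "\<dots> = (sqrt s * norm (x - y))\<^sup>2"
    by (simp add: power_mult_distrib s_def)
  finally show "norm ((x - A x) - (y - A y)) \<le> sqrt s * norm (x - y)"
    by (rule power2_le_imp_le) (simp add: s_def)
qed

text \<open>Each solution is tested against the other; the sum of the two inequalities is opposite
  in sign to strong monotonicity.\<close>

lemma VI_solution_unique:
  assumes "strongly_monotone \<kappa> A" "\<kappa> > 0" "VI_solution S A z" "VI_solution S A z'"
  shows "z' = z"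
proof -
  have "\<kappa> * (norm (z - z'))\<^sup>2 \<le> inner (z - z') (A z - A z')"
    using assms(1) by (simp add: strongly_monotone_def)
  also have "\<dots> = - inner (z' - z) (A z) - inner (z - z') (A z')"
    by (simp add: inner_diff_left inner_diff_right)
  also have "\<dots> \<le> 0"
    using assms(3,4) unfolding VI_solution_def by (smt (verit))
  finally show ?thesis
    using \<open>\<kappa> > 0\<close> by (simp add: mult_le_0_iff)
qed

section \<open>Comparison of the two iterations\<close>

lemma tendsto_0_if_contractive_recursion:
  fixes a b c :: "nat \<Rightarrow> real"
  assumes rec: "\<And>n. a (Suc n) \<le> (1 - c n) * a n + c n * b n"
    and a_nonneg: "\<And>n. 0 \<le> a n"
    and c_nonneg: "\<And>n. 0 \<le> c n" and c_le_1: "\<And>n. c n \<le> 1"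
    and c_sum: "filterlim (\<lambda>n. \<Sum>k<n. c k) at_top sequentially"
    and b: "b \<longlonglongrightarrow> 0"
  shows "a \<longlonglongrightarrow> 0"
proof (rule tendstoI)
  fix e :: real assume "e > 0"
  define S where "S n = (\<Sum>k<n. c k)" for n
  \<comment> \<open>The excess of \<open>a n\<close> over \<open>e / 2\<close>. Once
    \<open>b n < e / 2\<close>, it shrinks at each step by the factor \<open>1 - c n\<close>, which
    is at most \<open>exp (- c n)\<close>. Hence \<open>d n * exp (S n)\<close> is eventually
    nonincreasing, and divergence of \<open>S\<close> drives \<open>d\<close> to 0.\<close>
  define d where "d n = max 0 (a n - e / 2)" for n
  have "\<forall>\<^sub>F n in sequentially. b n < e / 2"
    using b \<open>e > 0\<close> by (intro order_tendstoD) auto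
  then obtain N where N: "\<And>n. n \<ge> N \<Longrightarrow> b n < e / 2"
    by (auto simp: eventually_sequentially)
  have step: "d (Suc n) * exp (S (Suc n)) \<le> d n * exp (S n)" if "n \<ge> N" for n
  proof -
    have "a (Suc n) - e / 2 \<le> (1 - c n) * a n + c n * b n - e / 2"
      using rec[of n] by simp
    also have "\<dots> \<le> (1 - c n) * a n + c n * (e / 2) - e / 2"
      using N[OF that] c_nonneg[of n] by (intro diff_right_mono add_left_mono mult_left_mono) auto
    also have "\<dots> = (1 - c n) * (a n - e / 2)"
      by (simp add: field_simps)
    also have "\<dots> \<le> (1 - c n) * d n"
      using c_le_1[of n] by (intro mult_left_mono) (auto simp: d_def)
    finally have "d (Suc n) \<le> (1 - c n) * d n"
      using c_le_1[of n] by (simp add: d_def)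
    also have "\<dots> \<le> exp (- c n) * d n"
      using exp_ge_add_one_self[of "- c n"] by (intro mult_right_mono) (auto simp: d_def)
    finally have "d (Suc n) * exp (S (Suc n)) \<le> exp (- c n) * d n * exp (S (Suc n))"
      by (intro mult_right_mono) auto
    also have "\<dots> = d n * exp (S n)"
      by (simp add: S_def exp_add exp_minus)
    finally show ?thesis .
  qed
  have "d n * exp (S n) \<le> d N * exp (S N)" if "n \<ge> N" for n
    using that by (induction rule: dec_induct) (auto intro: order_trans[OF step])
  then have d_bound: "d n \<le> d N * exp (S N) * exp (- S n)" if "n \<ge> N" for n
    using that by (simp add: exp_minus field_simps)
  have "filterlim (\<lambda>n. - S n) at_bot sequentially"
    using c_sum by (simp add: filterlim_uminus_at_top S_def)
  then have "(\<lambda>n. exp (- S n)) \<longlonglongrightarrow> 0"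
    by (rule filterlim_compose[OF exp_at_bot])
  then have "(\<lambda>n. d N * exp (S N) * exp (- S n)) \<longlonglongrightarrow> 0"
    by (rule tendsto_mult_right_zero)
  then have "\<forall>\<^sub>F n in sequentially. d N * exp (S N) * exp (- S n) < e / 2"
    using \<open>e > 0\<close> by (intro order_tendstoD) auto
  then show "\<forall>\<^sub>F n in sequentially. dist (a n) 0 < e"
    using eventually_ge_at_top[of N]
  proof eventually_elim
    case (elim n)
    then have "d n < e / 2"
      using d_bound[of n] by linarith
    then show ?case
      using a_nonneg[of n] unfolding d_def dist_real_def by linarith
  qed
qed

text \<open>The sequence \<open>x\<close> uses the fixed anchor \<open>f z\<close> where
  \<open>y\<close> uses the moving anchor \<open>f (T n (y n))\<close>. The anchors differ by at
  most \<open>r * norm (y n - z)\<close>, and \<open>r < 1\<close> leaves a genuine contraction in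
  the recursion for \<open>norm (y n - x n)\<close>.\<close>

lemma viscosity_iteration_tendsto:
  fixes T :: "nat \<Rightarrow> 'a::real_normed_vector \<Rightarrow> 'a"
  assumes T: "\<And>n. n \<ge> 1 \<Longrightarrow> nonexpansive (T n)" "\<And>n. n \<ge> 1 \<Longrightarrow> T n z = z"
    and r: "0 \<le> r" "r < 1"
    and f: "\<And>u v. norm (f u - f v) \<le> r * norm (u - v)"
    and lam: "\<And>n. n \<ge> 1 \<Longrightarrow> lam n \<in> {0..1}"
    and lam_sum: "filterlim (\<lambda>N. \<Sum>n=1..N. lam n) at_top sequentially"
    and x_rec: "\<And>n. n \<ge> 1 \<Longrightarrow> x (n + 1) = lam n *\<^sub>R f z + (1 - lam n) *\<^sub>R T n (x n)"
    and x_lim: "x \<longlonglongrightarrow> z"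
    and y_rec: "\<And>n. n \<ge> 1 \<Longrightarrow> y (n + 1) = lam n *\<^sub>R f (T n (y n)) + (1 - lam n) *\<^sub>R T n (y n)"
  shows "y \<longlonglongrightarrow> z"
proof -
  \<comment> \<open>The iterations start at index 1 and the recursion lemma at 0, hence the shift.
    The coefficient of \<open>a n\<close> will be \<open>lam m * r + (1 - lam m)\<close> with
    \<open>m = Suc n\<close>, which dictates \<open>c\<close>; the factor \<open>r / (1 - r)\<close>
    in \<open>b\<close> makes \<open>c n * b n\<close> equal to the remaining error
    \<open>lam m * r * norm (x m - z)\<close>.\<close>
  define a where "a n = norm (y (Suc n) - x (Suc n))" for n
  define b where "b n = r / (1 - r) * norm (x (Suc n) - z)" for n
  define c where "c n = (1 - r) * lam (Suc n)" for n
  have "a \<longlonglongrightarrow> 0"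
  proof (rule tendsto_0_if_contractive_recursion)
    fix n
    define m where "m = Suc n"
    have m: "m \<ge> 1" and lam_m: "0 \<le> lam m" "lam m \<le> 1"
      using lam[of m] by (auto simp: m_def)
    have "norm (f (T m (y m)) - f z) \<le> r * norm (T m (y m) - T m z)"
      using f T(2)[OF m] by metis
    also have "\<dots> \<le> r * norm (y m - z)"
      using T(1)[OF m] r by (intro mult_left_mono) (auto simp: nonexpansive_def)
    \<comment> \<open>Passing through \<open>x m\<close> trades the unknown error of
      \<open>y\<close> for the difference under study plus a term already known to vanish.\<close>
    also have "\<dots> \<le> r * (norm (y m - x m) + norm (x m - z))"
      using r norm_triangle_ineq[of "y m - x m" "x m - z"] by (intro mult_left_mono) auto
    finally have f_le: "norm (f (T m (y m)) - f z) \<le> r * (norm (y m - x m) + norm (x m - z))" .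
    have "y (m + 1) - x (m + 1) =
        lam m *\<^sub>R (f (T m (y m)) - f z) + (1 - lam m) *\<^sub>R (T m (y m) - T m (x m))"
      unfolding x_rec[OF m] y_rec[OF m] by (simp add: algebra_simps)
    then have "norm (y (m + 1) - x (m + 1)) \<le>
        lam m * norm (f (T m (y m)) - f z) + (1 - lam m) * norm (T m (y m) - T m (x m))"
      using lam_m by (metis abs_of_nonneg diff_ge_0_iff_ge norm_scaleR norm_triangle_ineq)
    also have "\<dots> \<le> lam m * (r * (norm (y m - x m) + norm (x m - z))) + (1 - lam m) * norm (y m - x m)"
      using f_le T(1)[OF m] lam_m by (intro add_mono mult_left_mono) (auto simp: nonexpansive_def)
    also have "\<dots> = (1 - c n) * a n + c n * b n"
      using r by (simp add: a_def b_def c_def m_def field_simps)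
    finally show "a (Suc n) \<le> (1 - c n) * a n + c n * b n"
      by (simp add: a_def m_def)
    show "0 \<le> a n"
      by (simp add: a_def)
    show "0 \<le> c n" "c n \<le> 1"
      using r lam_m by (auto simp: c_def m_def intro: mult_le_one)
  next
    have "filterlim (\<lambda>n. (1 - r) * (\<Sum>k=1..n. lam k)) at_top sequentially"
      using r by (intro filterlim_tendsto_pos_mult_at_top[OF tendsto_const _ lam_sum]) auto
    then show "filterlim (\<lambda>n. \<Sum>k<n. c k) at_top sequentially"
      by (simp add: c_def sum.atLeast1_atMost_eq flip: sum_distrib_left)
  next
    have "b \<longlonglongrightarrow> r / (1 - r) * norm (z - z)"
      unfolding b_def by (intro tendsto_intros LIMSEQ_Suc[OF x_lim])
    then show "b \<longlonglongrightarrow> 0"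
      by simp
  qed
  then have "(\<lambda>n. y (Suc n) - x (Suc n)) \<longlonglongrightarrow> 0"
    unfolding a_def by (rule tendsto_norm_zero_cancel)
  from tendsto_add[OF this LIMSEQ_Suc[OF x_lim]] show ?thesis
    by (simp add: filterlim_sequentially_Suc)
qed

section \<open>Application to the variational inequality\<close>

theorem theorem3p2:
  fixes T :: "nat \<Rightarrow> 'a::{real_inner, complete_space} \<Rightarrow> 'a"
    and F :: "'a set"
    and A :: "'a \<Rightarrow> 'a"
    and \<kappa> \<eta> :: real
    and lam :: "nat \<Rightarrow> real"
    and y\<^sub>1 :: 'a
    and y :: "nat \<Rightarrow> 'a"
  assumes T_nonexpansive: "\<And>n. n \<ge> 1 \<Longrightarrow> nonexpansive (T n)"
    and F_eq: "F = (\<Inter>n\<in>{1..}. Fix (T n))"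
    and F_nonempty: "F \<noteq> {}"
    and kappa_pos: "\<kappa> > 0"
    and eta_pos: "\<eta> > 0"
    and eta_kappa: "\<eta>\<^sup>2 < 2 * \<kappa>"
    and A_strongly_monotone: "strongly_monotone \<kappa> A"
    and A_lipschitz: "\<eta>-lipschitz_on UNIV A"
    and lambda_range: "\<And>n. n \<ge> 1 \<Longrightarrow> lam n \<in> {0..1}"
    and lambda_sum: "filterlim (\<lambda>N. \<Sum>n=1..N. lam n) at_top sequentially"
    and halpern: "\<And>x u xs. xs 1 = x \<Longrightarrow>
        (\<And>n. n \<ge> 1 \<Longrightarrow> xs (n + 1) = lam n *\<^sub>R u + (1 - lam n) *\<^sub>R T n (xs n)) \<Longrightarrow>
        xs \<longlonglongrightarrow> metric_proj F u"
    and y_init: "y 1 = y\<^sub>1"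
    and y_rec: "\<And>n. n \<ge> 1 \<Longrightarrow> y (n + 1) = T n (y n) - lam n *\<^sub>R A (T n (y n))"
  shows "\<exists>z. VI_solution F A z \<and> (\<forall>z'. VI_solution F A z' \<longrightarrow> z' = z) \<and> y \<longlonglongrightarrow> z"
proof -
  have "closed F" "convex F"
    unfolding F_eq using T_nonexpansive
    by (auto intro!: closed_INT convex_INT closed_Fix convex_Fix)
  note proj = metric_proj_nearest[OF this F_nonempty]
    and proj_nonexpansive = nonexpansive_metric_proj[OF this F_nonempty]
    and proj_inner = metric_proj_inner_le_0[OF this]
  obtain r where r: "0 \<le> r" "r < 1"
    and contr: "\<And>u v. norm ((u - A u) - (v - A v)) \<le> r * norm (u - v)"
    using contraction_id_minus_strongly_monotone[OF A_strongly_monotone A_lipschitz eta_kappa]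
    by blast
  have "dist (metric_proj F (u - A u)) (metric_proj F (v - A v)) \<le> r * dist u v" for u v
    using proj_nonexpansive contr[of u v] unfolding nonexpansive_def dist_norm
    by (meson order_trans)
  then obtain z where z: "metric_proj F (z - A z) = z"
    using banach_fix_type[OF r, of "\<lambda>u. metric_proj F (u - A u)"] by auto
  have "z \<in> F"
    using proj[of "z - A z"] z by simp
  moreover have "inner (w - z) (A z) \<ge> 0" if "w \<in> F" for w
    using proj_inner[OF that, of "z - A z"] by (simp add: z inner_commute)
  ultimately have VI: "VI_solution F A z"
    by (simp add: VI_solution_def)
  \<comment> \<open>A Halpern sequence with anchor \<open>z - A z\<close> and starting value
    \<open>xs 1 = z\<close>. The branch \<open>n = 0\<close> sets this start and keeps the
    unconstrained \<open>lam 0\<close> and \<open>T 0\<close> out; \<open>xs 0\<close> is a dummy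
    value.\<close>
  define xs where "xs = rec_nat z (\<lambda>n p. if n = 0 then z
      else lam n *\<^sub>R (z - A z) + (1 - lam n) *\<^sub>R T n p)"
  have xs_rec: "xs (n + 1) = lam n *\<^sub>R (z - A z) + (1 - lam n) *\<^sub>R T n (xs n)"
    if "n \<ge> 1" for n
    using that by (simp add: xs_def)
  \<comment> \<open>The Halpern limit is the projection of the anchor \<open>z - A z\<close>, which
    is \<open>z\<close> by the choice of \<open>z\<close> as a fixed point.\<close>
  have xs_lim: "xs \<longlonglongrightarrow> z"
    using halpern[OF refl xs_rec] by (simp add: z)
  have T_z: "T n z = z" if "n \<ge> 1" for n
    using \<open>z \<in> F\<close> that by (auto simp: F_eq Fix_def)
  have y_rec': "y (n + 1) = lam n *\<^sub>R (T n (y n) - A (T n (y n))) + (1 - lam n) *\<^sub>R T n (y n)"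
    if "n \<ge> 1" for n
    using y_rec[OF that] by (simp add: algebra_simps)
  have "y \<longlonglongrightarrow> z"
    by (rule viscosity_iteration_tendsto[where f = "\<lambda>u. u - A u",
          OF T_nonexpansive T_z r contr lambda_range lambda_sum xs_rec xs_lim y_rec'])
  with VI VI_solution_unique[OF A_strongly_monotone kappa_pos VI] show ?thesis
    by blast
qed

end
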